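(* Let $j\in\{2,3,4\}$, $\lambda\in\{1,-1\}$, let $r>0$ be constant, and let $\beta$ be a unit-speed spacelike curve in $\mathbb{E}^4_1$ with non-null Frenet frame $\{F_1,F_2,F_3,F_4\}$ whose timelike member is $F_j$. Let $M$ be the tubular hypersurface $$\mathcal{T}^{\{j,\lambda\}}(s,t,w)=\beta(s)+r\sum_{i=2}^4\mu_i^{\lambda}F_i(s)$$ with Gauss map $N^{\{j,\lambda\}}=-(-1)^{(4-j)!}\lambda^j\sum_{i=2}^4\mu_i^\lambda F_i$. Then $M$ does not have first kind $\mathcal{L}_2$-pointwise 1-type Gauss map; that is, there does not exist a non-zero smooth function $\mathfrak{m}$ on $M$ such that $\mathcal{L}_2N^{\{j,\lambda\}}=\mathfrak{m}N^{\{j,\lambda\}}$.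
   Context: $\mathbb{E}^4_1$ is $\mathbb{R}^4$ with the metric $\langle\ ,\ \rangle=-dx_1^2+dx_2^2+dx_3^2+dx_4^2$. The curve $\beta:I\to\mathbb{E}^4_1$ ($I$ an open interval) is smooth with $\beta'=F_1$, and $\{F_1,\dots,F_4\}$ is a smooth orthonormal frame along $\beta$ with $\langle F_j,F_j\rangle=-1$ and $\langle F_i,F_i\rangle=1$ for $i\neq j$, satisfying, with smooth curvature functions $k_1,k_2,k_3$ of $s$, the Frenet equations - $j=2$: $F_1'=k_1F_2$, $F_2'=k_1F_1+k_2F_3$, $F_3'=k_2F_2+k_3F_4$, $F_4'=-k_3F_3$; - $j=3$: $F_1'=k_1F_2$, $F_2'=-k_1F_1+k_2F_3$, $F_3'=k_2F_2+k_3F_4$, $F_4'=k_3F_3$; - $j=4$: $F_1'=k_1F_2$, $F_2'=-k_1F_1+k_2F_3$, $F_3'=-k_2F_2+k_3F_4$, $F_4'=k_3F_3$. The functions $\mu_i^\lambda$ (depending on $j$) are given by $\mu_j^\lambda=(\sinh w)^{\frac{1+\lambda}2}(\cosh w)^{\frac{1-\lambda}2}\cosh t$, $\mu_{j+1}^\lambda=(\sinh w)^{\frac{1-\lambda}2}(\cosh w)^{\frac{1+\lambda}2}$, $\mu_{j+2}^\lambda=(\sinh w)^{\frac{1+\lambda}2}(\cosh w)^{\frac{1-\lambda}2}\sinh t$, with the index convention $\mu_5^\lambda=\mu_2^\lambda$, $\mu_6^\lambda=\mu_3^\lambda$. ($\lambda=1$: envelope of pseudo hyperspheres; $\lambda=-1$: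 envelope of pseudo hyperbolic hyperspheres, of radius $r$ centered on $\beta$.) The parameters $(s,t,w)$ range over a connected open set $U\subset I\times\mathbb{R}^2$ projecting onto $I$ on which $\mathcal{T}^{\{j,\lambda\}}$ is an immersion, i.e. $(\mu_{j+1}^\lambda)_w\neq0$ and $1+(-1)^{(4-j)!}rk_1\mu_2^\lambda\neq0$. The unit normal $N=N^{\{j,\lambda\}}$ has $\varepsilon=\langle N,N\rangle=\lambda$, and the principal curvatures with respect to $N$ (eigenvalues of $-dN$) are $\kappa_1=\kappa_2=\frac{(-1)^{(4-j)!}\lambda^j}{r}$, $\kappa_3=\frac{k_1\mu_2^\lambda}{\lambda^j(1+(-1)^{(4-j)!}rk_1\mu_2^\lambda)}$. Operator $\mathcal{L}_2$ on the Gauss map: put $a_1=-\sum_i\kappa_i$, $a_k=(-1)^k\sum_{i_1<\dots<i_k}\kappa_{i_1}\cdots\kappa_{i_k}$ ($k=2,3$), and define $H_k$ by $\binom{3}{k}H_k=(-\varepsilon)^ka_k$. Then $$\mathcal{L}_2N=-\varepsilon\,\mathfrak{C}_2\big(\nabla H_3+3H_1H_3\,N\big),\qquad \mathfrak{C}_2=\binom33(-\varepsilon)^2=1,$$ where $\nabla$ is the gradient on $M$ with respect to the induced metric, viewed as an $\mathbb{E}^4_1$-valued map. "Non-zero function" means not identically zero. *)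

theory Defs
  imports "HOL-Analysis.Analysis" "HOL-Computational_Algebra.Polynomial"
begin

text \<open>Lorentz-Minkowski space is \<^typ>\<open>real^4\<close> with the following bilinear form.\<close>

definition mink :: "real^4 \<Rightarrow> real^4 \<Rightarrow> real" where
  "mink x y = - (x$1 * y$1) + x$2 * y$2 + x$3 * y$3 + x$4 * y$4"

text \<open>Smoothness (all orders) on an open set.\<close>

primrec differentiable_upto ::
  "nat \<Rightarrow> ('a::real_normed_vector \<Rightarrow> 'b::real_normed_vector) \<Rightarrow> 'a set \<Rightarrow> bool" where
  "differentiable_upto 0 f U \<longleftrightarrow> continuous_on U f"
| "differentiable_upto (Suc n) f U \<longleftrightarrow>
     (\<forall>x\<in>U. f differentiable (at x)) \<and>
     (\<forall>v. differentiable_upto n (\<lambda>x. frechet_derivative f (at x) v) U)"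

definition smooth_on ::
  "'a::real_normed_vector set \<Rightarrow> ('a \<Rightarrow> 'b::real_normed_vector) \<Rightarrow> bool" where
  "smooth_on U f \<longleftrightarrow> (\<forall>n. differentiable_upto n f U)"


section \<open>Frenet curves\<close>

text \<open>
  The frame is \<open>F 1, ..., F 4\<close> and the curvatures are \<open>k 1, k 2, k 3\<close>; values at other
  indices are irrelevant. The curve is spacelike and unit speed since its
  velocity is \<open>F 1\<close> and the timelike index \<open>j\<close> lies in \<open>{2, 3, 4}\<close>.
\<close>

definition frenet_equations ::
  "nat \<Rightarrow> (nat \<Rightarrow> real \<Rightarrow> real^4) \<Rightarrow> (nat \<Rightarrow> real \<Rightarrow> real) \<Rightarrow> real \<Rightarrow> bool" where
  "frenet_equations j F k s \<longleftrightarrow>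
     (if j = 2 then
        (F 1 has_vector_derivative k 1 s *\<^sub>R F 2 s) (at s) \<and>
        (F 2 has_vector_derivative k 1 s *\<^sub>R F 1 s + k 2 s *\<^sub>R F 3 s) (at s) \<and>
        (F 3 has_vector_derivative k 2 s *\<^sub>R F 2 s + k 3 s *\<^sub>R F 4 s) (at s) \<and>
        (F 4 has_vector_derivative - k 3 s *\<^sub>R F 3 s) (at s)
      else if j = 3 then
        (F 1 has_vector_derivative k 1 s *\<^sub>R F 2 s) (at s) \<and>
        (F 2 has_vector_derivative - k 1 s *\<^sub>R F 1 s + k 2 s *\<^sub>R F 3 s) (at s) \<and>
        (F 3 has_vector_derivative k 2 s *\<^sub>R F 2 s + k 3 s *\<^sub>R F 4 s) (at s) \<and>
        (F 4 has_vector_derivative k 3 s *\<^sub>R F 3 s) (at s)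
      else
        (F 1 has_vector_derivative k 1 s *\<^sub>R F 2 s) (at s) \<and>
        (F 2 has_vector_derivative - k 1 s *\<^sub>R F 1 s + k 2 s *\<^sub>R F 3 s) (at s) \<and>
        (F 3 has_vector_derivative - k 2 s *\<^sub>R F 2 s + k 3 s *\<^sub>R F 4 s) (at s) \<and>
        (F 4 has_vector_derivative k 3 s *\<^sub>R F 3 s) (at s))"

definition frenet_curve ::
  "nat \<Rightarrow> real set \<Rightarrow> (real \<Rightarrow> real^4) \<Rightarrow> (nat \<Rightarrow> real \<Rightarrow> real^4) \<Rightarrow> (nat \<Rightarrow> real \<Rightarrow> real) \<Rightarrow> bool"
where
  "frenet_curve j I \<beta> F k \<longleftrightarrow>
     smooth_on I \<beta> \<and> (\<forall>i\<in>{1..4}. smooth_on I (F i)) \<and> (\<forall>i\<in>{1..3}. smooth_on I (k i)) \<and>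
     (\<forall>s\<in>I. (\<beta> has_vector_derivative F 1 s) (at s)) \<and>
     (\<forall>s\<in>I. \<forall>i\<in>{1..4}. \<forall>l\<in>{1..4}.
        mink (F i s) (F l s) = (if i \<noteq> l then 0 else if i = j then - 1 else 1)) \<and>
     (\<forall>s\<in>I. frenet_equations j F k s)"


section \<open>Tubular hypersurfaces\<close>

text \<open>
  \<open>mu j lam i t w\<close> is used for \<open>j, i \<in> {2, 3, 4}\<close> and \<open>lam \<in> {1, -1}\<close> only.
  Both exponents are then 0 or 1. The three branches are the indices \<open>j\<close>, \<open>j + 1\<close>, \<open>j + 2\<close>,
  where 5 and 6 are read as 2 and 3.
\<close>

definition wrap_index :: "nat \<Rightarrow> nat" where
  "wrap_index n = (if n > 4 then n - 3 else n)"

definition mu :: "nat \<Rightarrow> int \<Rightarrow> nat \<Rightarrow> real \<Rightarrow> real \<Rightarrow> real" where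
  "mu j lam i t w =
     (if i = j then
        sinh w powi ((1 + lam) div 2) * cosh w powi ((1 - lam) div 2) * cosh t
      else if i = wrap_index (j + 1) then
        sinh w powi ((1 - lam) div 2) * cosh w powi ((1 + lam) div 2)
      else
        sinh w powi ((1 + lam) div 2) * cosh w powi ((1 - lam) div 2) * sinh t)"

text \<open>The parameter vector \<open>p\<close> has components \<open>s = p $ 1\<close>, \<open>t = p $ 2\<close>, \<open>w = p $ 3\<close>.\<close>

definition tube ::
  "nat \<Rightarrow> int \<Rightarrow> real \<Rightarrow> (real \<Rightarrow> real^4) \<Rightarrow> (nat \<Rightarrow> real \<Rightarrow> real^4) \<Rightarrow> real^3 \<Rightarrow> real^4" where
  "tube j lam r \<beta> F p = \<beta> (p$1) + r *\<^sub>R (\<Sum>i=2..4. mu j lam i (p$2) (p$3) *\<^sub>R F i (p$1))"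

definition tube_normal ::
  "nat \<Rightarrow> int \<Rightarrow> (nat \<Rightarrow> real \<Rightarrow> real^4) \<Rightarrow> real^3 \<Rightarrow> real^4" where
  "tube_normal j lam F p =
     (- ((- 1) ^ fact (4 - j)) * of_int lam ^ j) *\<^sub>R
       (\<Sum>i=2..4. mu j lam i (p$2) (p$3) *\<^sub>R F i (p$1))"


section \<open>Parametrized hypersurfaces and the operator on the Gauss map\<close>

text \<open>
  A hypersurface is given by an immersion \<open>X\<close> of an open set of parameters, with unit
  normal \<open>N\<close>; functions on the hypersurface are functions of the parameters.
\<close>

definition immersion_on :: "(real^3) set \<Rightarrow> (real^3 \<Rightarrow> real^4) \<Rightarrow> bool" where
  "immersion_on U X \<longleftrightarrow>
     (\<forall>p\<in>U. X differentiable (at p) \<and> inj (frechet_derivative X (at p)))"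

definition pd :: "(real^3 \<Rightarrow> 'b::real_normed_vector) \<Rightarrow> 3 \<Rightarrow> real^3 \<Rightarrow> 'b" where
  "pd f i p = frechet_derivative f (at p) (axis i 1)"

definition induced_metric :: "(real^3 \<Rightarrow> real^4) \<Rightarrow> real^3 \<Rightarrow> real^3^3" where
  "induced_metric X p = (\<chi> i l. mink (pd X i p) (pd X l p))"

definition gradient :: "(real^3 \<Rightarrow> real^4) \<Rightarrow> (real^3 \<Rightarrow> real) \<Rightarrow> real^3 \<Rightarrow> real^4" where
  "gradient X f p =
     (\<Sum>i\<in>UNIV. \<Sum>l\<in>UNIV.
        (matrix_inv (induced_metric X p) $ i $ l * pd f l p) *\<^sub>R pd X i p)"

text \<open>The matrix of \<open>-dN\<close> with respect to the basis of coordinate vectors of the tangent space.\<close>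

definition shape_matrix :: "(real^3 \<Rightarrow> real^4) \<Rightarrow> (real^3 \<Rightarrow> real^4) \<Rightarrow> real^3 \<Rightarrow> real^3^3" where
  "shape_matrix X N p =
     (THE S. \<forall>i. - pd N i p = (\<Sum>l\<in>UNIV. (S $ l $ i) *\<^sub>R pd X l p))"

definition charpoly :: "real^'n^'n \<Rightarrow> real poly" where
  "charpoly A = det (mat [:0, 1:] - map_matrix (\<lambda>c. [:c:]) A)"

text \<open>
  The principal curvatures, for \<open>i = 1, 2, 3\<close>: the eigenvalues of \<open>-dN\<close>, repeated according to
  algebraic multiplicity. They are listed in increasing order, but only symmetric functions of
  them are used below.
\<close>

definition principal_curvature ::
  "(real^3 \<Rightarrow> real^4) \<Rightarrow> (real^3 \<Rightarrow> real^4) \<Rightarrow> nat \<Rightarrow> real^3 \<Rightarrow> real" where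
  "principal_curvature X N i p =
     sorted_list_of_multiset (proots (charpoly (shape_matrix X N p))) ! (i - 1)"

definition curv_coeff ::
  "(real^3 \<Rightarrow> real^4) \<Rightarrow> (real^3 \<Rightarrow> real^4) \<Rightarrow> nat \<Rightarrow> real^3 \<Rightarrow> real" where
  "curv_coeff X N k p =
     (- 1) ^ k * (\<Sum>A | A \<subseteq> {1..3} \<and> card A = k. \<Prod>i\<in>A. principal_curvature X N i p)"

definition normal_sign :: "(real^3 \<Rightarrow> real^4) \<Rightarrow> real^3 \<Rightarrow> real" where
  "normal_sign N p = mink (N p) (N p)"

definition mean_curv ::
  "(real^3 \<Rightarrow> real^4) \<Rightarrow> (real^3 \<Rightarrow> real^4) \<Rightarrow> nat \<Rightarrow> real^3 \<Rightarrow> real" where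
  "mean_curv X N k p = (- normal_sign N p) ^ k * curv_coeff X N k p / real (3 choose k)"

definition L2_gauss ::
  "(real^3 \<Rightarrow> real^4) \<Rightarrow> (real^3 \<Rightarrow> real^4) \<Rightarrow> real^3 \<Rightarrow> real^4" where
  "L2_gauss X N p =
     (- normal_sign N p * (real (3 choose 3) * (- normal_sign N p)\<^sup>2)) *\<^sub>R
       (gradient X (mean_curv X N 3) p +
        (3 * mean_curv X N 1 p * mean_curv X N 3 p) *\<^sub>R N p)"

definition first_kind_L2_pointwise_1_type ::
  "(real^3) set \<Rightarrow> (real^3 \<Rightarrow> real^4) \<Rightarrow> (real^3 \<Rightarrow> real^4) \<Rightarrow> bool" where
  "first_kind_L2_pointwise_1_type U X N \<longleftrightarrow>
     (\<exists>m :: real^3 \<Rightarrow> real. smooth_on U m \<and> (\<exists>p\<in>U. m p \<noteq> 0) \<and>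
        (\<forall>p\<in>U. L2_gauss X N p = m p *\<^sub>R N p))"

end

theory Submission
  imports Defs
begin

text \<open>
  The gradient of \<open>H\<^sub>3\<close> is tangent to \<open>M\<close>, so \<open>\<L>\<^sub>2 N = m N\<close> forces \<open>H\<^sub>3\<close> to be critical everywhere.
  Write \<open>N = \<sigma> n\<close>. The vectors \<open>\<partial>\<^sub>t n\<close> and \<open>\<partial>\<^sub>w n\<close> are eigenvectors of \<open>-dN\<close> with constant
  eigenvalue \<open>-\<sigma> / r\<close>, and the third eigenvalue is read off by pairing with \<open>F\<^sub>1\<close>; hence \<open>H\<^sub>3\<close> is a
  nonzero constant times \<open>x / (1 + e r x)\<close> with \<open>x = k\<^sub>1 \<mu>\<^sub>2\<close>. Its \<open>w\<close>-derivative is a nonzero multiple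
  of \<open>k\<^sub>1 \<partial>\<^sub>w \<mu>\<^sub>2\<close>, and \<open>\<partial>\<^sub>w \<mu>\<^sub>2 \<noteq> 0\<close> off \<open>t w = 0\<close>. As \<open>k\<^sub>1\<close> depends on \<open>s\<close> only and \<open>U\<close> is open,
  \<open>k\<^sub>1 = 0\<close> on all of \<open>I\<close>. But then \<open>H\<^sub>3 = 0\<close>, so \<open>\<L>\<^sub>2 N = 0\<close> and \<open>m = 0\<close>.
\<close>

section \<open>Nondegenerate hypersurfaces\<close>

lemma bounded_bilinear_mink: "bounded_bilinear mink"
  unfolding bilinear_conv_bounded_bilinear[symmetric] bilinear_def mink_def
  by (auto intro!: linearI simp: algebra_simps)

interpretation mink: bounded_bilinear mink
  by (rule bounded_bilinear_mink)

lemma mink_commute: "mink x y = mink y x"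
  by (simp add: mink_def mult.commute)

lemma mink_nondegenerate:
  assumes "\<And>y. mink x y = 0"
  shows "x = 0"
  using assms[of "axis 1 1"] assms[of "axis 2 1"] assms[of "axis 3 1"] assms[of "axis 4 1"]
  by (simp add: mink_def axis_def vec_eq_iff forall_4)

text \<open>The product rule. It turns \<open>mink n n = lam\<close> and
  \<open>mink (F 1) n = 0\<close> into facts about the differential of \<open>n\<close>, so that
  this differential is never expanded.\<close>

lemma mink_constant_derivative:
  assumes f: "(f has_derivative f') (at p)" and g: "(g has_derivative g') (at p)"
    and U: "open U" "p \<in> U" and c: "\<And>q. q \<in> U \<Longrightarrow> mink (f q) (g q) = c"
  shows "mink (f p) (g' v) + mink (f' v) (g p) = 0"
proof -
  have "((\<lambda>q. mink (f q) (g q)) has_derivative (\<lambda>v. mink (f p) (g' v) + mink (f' v) (g p))) (at p)"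
    by (rule mink.FDERIV[OF f g])
  moreover have "((\<lambda>q. mink (f q) (g q)) has_derivative (\<lambda>v. 0)) (at p)"
    by (rule has_derivative_transform_within_open[OF has_derivative_const U]) (simp add: c)
  ultimately show ?thesis
    using has_derivative_unique by metis
qed

lemma pd_eq:
  assumes "(f has_derivative f') (at p)"
  shows "pd f i p = f' (axis i 1)"
  unfolding pd_def frechet_derivative_at[OF assms, symmetric] ..

section \<open>Tangent space at a point with a non-null normal vector\<close>

locale hypersurface_point =
  fixes X :: "real^3 \<Rightarrow> real^4" and p :: "real^3" and N :: "real^4"
  assumes differentiable: "X differentiable (at p)"
    and injective: "inj (frechet_derivative X (at p))"
    and orthogonal: "\<And>v. mink (frechet_derivative X (at p) v) N = 0"
    and nonnull: "mink N N \<noteq> 0"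
begin

abbreviation "D \<equiv> frechet_derivative X (at p)"

lemma linear_D: "linear D"
  using differentiable by (simp add: linear_frechet_derivative)

lemma D_expansion: "D v = (\<Sum>i\<in>UNIV. (v $ i) *\<^sub>R pd X i p)"
proof -
  have "v = (\<Sum>i\<in>UNIV. (v $ i) *\<^sub>R axis i 1)"
    by (simp add: vec_eq_iff axis_def if_distrib cong: if_cong)
  then have "D v = D (\<Sum>i\<in>UNIV. (v $ i) *\<^sub>R axis i 1)"
    by simp
  also have "\<dots> = (\<Sum>i\<in>UNIV. (v $ i) *\<^sub>R pd X i p)"
    by (simp add: linear_sum[OF linear_D] linear_scale[OF linear_D] pd_def)
  finally show ?thesis .
qed

lemma D_eq_0: "D v = 0 \<Longrightarrow> v = 0"
  using injective linear_D linear_injective_0 by blast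

text \<open>A dimension count: non-nullity of \<open>N\<close> makes
  \<open>(v, c) \<mapsto> D v + c N\<close> injective, and both sides have dimension 4.\<close>

lemma tangent_normal_decomposition:
  obtains v c where "y = D v + c *\<^sub>R N"
proof -
  define f :: "(real^3) \<times> real \<Rightarrow> real^4" where "f = (\<lambda>(v, c). D v + c *\<^sub>R N)"
  have lin: "linear f"
    unfolding f_def using linear_D
    by (auto intro!: linearI simp: linear_add linear_scale algebra_simps)
  have "x = 0" if "f x = 0" for x
  proof -
    obtain v c where x: "x = (v, c)"
      by force
    have eq: "D v + c *\<^sub>R N = 0"
      using that by (simp add: f_def x)
    have "mink (D v + c *\<^sub>R N) N = c * mink N N"
      by (simp add: mink.add_left mink.scaleR_left orthogonal)
    then have "c = 0"
      using eq nonnull by (simp add: mink.zero_left)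
    then show "x = 0"
      using eq D_eq_0 by (simp add: x zero_prod_def)
  qed
  then have "inj f"
    using lin linear_injective_0 by blast
  then have "surj f"
    using lin by (intro linear_injective_imp_surjective) (simp_all add: dim_UNIV)
  then obtain z where "y = f z"
    by (rule surjE)
  then show thesis
    using that[of "fst z" "snd z"] by (simp add: f_def case_prod_beta)
qed

lemma tangent_cases:
  assumes "mink y N = 0"
  obtains v where "y = D v"
proof -
  obtain v c where y: "y = D v + c *\<^sub>R N"
    by (rule tangent_normal_decomposition)
  have "c * mink N N = 0"
    using assms by (simp add: y mink.add_left mink.scaleR_left orthogonal)
  then show thesis
    using that y nonnull by simp
qed

lemma orthogonal_to_all:
  assumes "mink y N = 0" and "\<And>i. mink y (pd X i p) = 0"
  shows "y = 0"
proof (rule mink_nondegenerate)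
  fix z
  obtain v c where z: "z = D v + c *\<^sub>R N"
    by (rule tangent_normal_decomposition)
  show "mink y z = 0"
    by (simp add: z mink.add_right mink.scaleR_right assms D_expansion mink.sum_right)
qed

text \<open>A kernel vector of this Gram matrix yields a tangent vector orthogonal to the tangent
  space and to \<open>N\<close>, hence zero by nondegeneracy.\<close>

lemma invertible_induced_metric: "invertible (induced_metric X p)"
proof -
  have "v = 0" if "induced_metric X p *v v = 0" for v
  proof -
    have "mink (D v) (pd X i p) = 0" for i
    proof -
      have "mink (D v) (pd X i p) = (induced_metric X p *v v) $ i"
        unfolding mink_commute[of "D v"]
        by (simp add: D_expansion mink.sum_right mink.scaleR_right induced_metric_def
            matrix_vector_mult_def mult.commute)
      then show ?thesis
        using that by simp
    qed
    then show "v = 0"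
      using orthogonal_to_all[of "D v"] orthogonal D_eq_0 by blast
  qed
  then show ?thesis
    unfolding invertible_left_inverse matrix_left_invertible_ker by blast
qed

text \<open>A gradient is tangent, so a normal one is zero; inverting the metric then kills every
  partial derivative.\<close>

lemma gradient_normal:
  assumes "gradient X f p = c *\<^sub>R N"
  shows "pd f l p = 0"
proof -
  let ?G = "induced_metric X p" and ?d = "\<chi> l. pd f l p"
  \<comment> \<open>\<open>matrix_inv\<close> is a Hilbert choice, so its inverse property has to be
    extracted from invertibility.\<close>
  have inv: "?G ** matrix_inv ?G = mat 1"
    using invertible_induced_metric unfolding invertible_def matrix_inv_def
    by (rule someI2_ex) blast
  have grad: "gradient X f p = D (matrix_inv ?G *v ?d)"
    by (simp add: gradient_def D_expansion matrix_vector_mult_def scaleR_sum_left)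
  have "mink (D (matrix_inv ?G *v ?d)) N = c * mink N N"
    using assms grad by (simp add: mink.scaleR_left)
  then have "c = 0"
    using orthogonal nonnull by simp
  then have "matrix_inv ?G *v ?d = 0"
    using assms grad D_eq_0 by simp
  then have "?G *v (matrix_inv ?G *v ?d) = 0"
    by simp
  then have "?d = 0"
    by (simp add: matrix_vector_mul_assoc inv)
  then show ?thesis
    by (simp add: vec_eq_iff)
qed

section \<open>Shape matrix and third mean curvature\<close>

lemma shape_matrix_eqI:
  assumes "\<And>i. - pd M i p = D (column i S)"
  shows "shape_matrix X M p = S"
  unfolding shape_matrix_def
proof (rule the_equality)
  show "\<forall>i. - pd M i p = (\<Sum>l\<in>UNIV. (S $ l $ i) *\<^sub>R pd X l p)"
    using assms by (simp add: D_expansion column_def)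
next
  fix T assume "\<forall>i. - pd M i p = (\<Sum>l\<in>UNIV. (T $ l $ i) *\<^sub>R pd X l p)"
  then have "D (column i T) = D (column i S)" for i
    using assms[of i] by (simp add: D_expansion column_def)
  then have "column i T = column i S" for i
    using injective by (simp add: inj_eq)
  then show "T = S"
    by (simp add: column_def vec_eq_iff)
qed

end

text \<open>The order of the sorted roots is irrelevant because only their product enters. The sign
  in \<open>curv_coeff\<close> cancels against the one in
  \<open>(- normal_sign N p) ^ 3\<close>.\<close>

lemma mean_curv_3_eq:
  assumes charpoly: "charpoly (shape_matrix X N p) = [:-a, 1:] * [:-b, 1:] * [:-c, 1:]"
  shows "mean_curv X N 3 p = normal_sign N p ^ 3 * (a * b * c)"
proof -
  define xs where "xs = sorted_list_of_multiset (proots (charpoly (shape_matrix X N p)))"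
  have "proots (charpoly (shape_matrix X N p)) = {#a, b, c#}"
    unfolding charpoly by (simp add: proots_mult del: mult_pCons_left mult_pCons_right)
  then have mset: "mset xs = {#a, b, c#}"
    by (simp add: xs_def)
  then have len: "length xs = 3"
    by (metis size_mset size_add_mset size_empty numeral_3_eq_3)
  have "(\<Prod>i\<in>{1..3}. principal_curvature X N i p) = prod_list xs"
    using len unfolding principal_curvature_def xs_def[symmetric]
    by (auto simp: numeral_3_eq_3 length_Suc_conv prod.atLeast_Suc_atMost)
  also have "\<dots> = a * b * c"
    by (metis mset prod_mset_prod_list prod_mset.add_mset prod_mset_empty mult.assoc mult_1_right)
  finally have prod: "(\<Prod>i\<in>{1..3}. principal_curvature X N i p) = a * b * c" .
  \<comment> \<open>The sum over 3-element subsets has a single term.\<close>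
  have "{A. A \<subseteq> {1..3} \<and> card A = 3} = {{1..3::nat}}"
    using card_subset_eq[of "{1..3::nat}"] by auto
  then show ?thesis
    using prod by (simp add: mean_curv_def curv_coeff_def power3_eq_cube)
qed

text \<open>The zero pattern says that the second and third coordinate vectors are eigenvectors, as
  happens for the tube.\<close>

lemma charpoly_block_triangular:
  fixes S :: "real^3^3"
  assumes "S$1$2 = 0" "S$3$2 = 0" "S$1$3 = 0" "S$2$3 = 0"
  shows "charpoly S = [:- (S$1$1), 1:] * [:- (S$2$2), 1:] * [:- (S$3$3), 1:]"
  by (simp add: charpoly_def det_3 mat_def map_matrix_def assms)


section \<open>The geometry of the tube\<close>

lemma has_derivative_vec_nth: "((\<lambda>p. p $ i) has_derivative (\<lambda>v. v $ i)) F"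
  by (rule bounded_linear_imp_has_derivative[OF bounded_linear_vec_nth])

text \<open>Each coefficient is a product \<open>f w * g t\<close> of hyperbolic functions or 1, so
  its \<open>w\<close>-derivative \<open>f' w * g t\<close> can vanish only where \<open>t\<close>
  or \<open>w\<close> does.\<close>

lemma mu_has_derivative:
  assumes "j \<in> {2, 3, 4}" "lam \<in> {1, - 1}" "i \<in> {2, 3, 4}"
  obtains D where "((\<lambda>p::real^3. mu j lam i (p$2) (p$3)) has_derivative D) (at p)"
    and "p$2 \<noteq> 0 \<Longrightarrow> p$3 \<noteq> 0 \<Longrightarrow> D (axis 3 1) \<noteq> 0"
proof -
  \<comment> \<open>\<open>c\<close> decides whether the \<open>w\<close>-factor is
    \<open>cosh\<close>: at index \<open>j + 1\<close> this happens for \<open>lam = 1\<close>, at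
    the other two for \<open>lam = - 1\<close>.\<close>
  define c where "c \<longleftrightarrow> (i = wrap_index (j + 1)) = (lam = 1)"
  define f f' :: "real \<Rightarrow> real" where "f = (if c then cosh else sinh)" and "f' = (if c then sinh else cosh)"
  define g g' :: "real \<Rightarrow> real" where
    "g = (if i = j then cosh else if i = wrap_index (j + 1) then \<lambda>_. 1 else sinh)" and
    "g' = (if i = j then sinh else if i = wrap_index (j + 1) then \<lambda>_. 0 else cosh)"
  have "mu j lam i t w = f w * g t" for t w
  proof (cases "lam = 1")
    case True
    then show ?thesis
      using assms(1) by (auto simp: mu_def f_def g_def c_def wrap_index_def)
  next
    case False
    then have "lam = - 1"
      using assms by simp
    then show ?thesis
      using assms(1) by (auto simp: mu_def f_def g_def c_def wrap_index_def)
  qed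
  moreover have "(f has_field_derivative f' w) (at w)" "(g has_field_derivative g' w) (at w)" for w
    by (auto simp: f_def f'_def g_def g'_def intro!: derivative_eq_intros)
  then have "((\<lambda>p::real^3. f (p$3) * g (p$2)) has_derivative
      (\<lambda>v. f (p$3) * (v$2 * g' (p$2)) + v$3 * f' (p$3) * g (p$2))) (at p)"
    by (intro has_derivative_mult DERIV_compose_FDERIV has_derivative_vec_nth)
  moreover have "f' w \<noteq> 0" "g t \<noteq> 0" if "w \<noteq> 0" "t \<noteq> 0" for t w
    using that by (auto simp: f'_def g_def)
  ultimately show thesis
    by (intro that[of "\<lambda>v. f (p$3) * (v$2 * g' (p$2)) + v$3 * f' (p$3) * g (p$2)"])
      (simp_all add: axis_def)
qed

lemma sum_2_4: "(\<Sum>i=2..4. f i) = f 2 + f 3 + f (4::nat)" for f :: "nat \<Rightarrow> 'a::comm_monoid_add"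
  by (simp add: eval_nat_numeral add.assoc)

lemma smooth_on_differentiable:
  assumes "smooth_on I f" "x \<in> I"
  shows "f differentiable (at x)"
proof -
  have "differentiable_upto (Suc 0) f I"
    using assms(1) by (simp only: smooth_on_def)
  then show ?thesis
    using assms(2) by simp
qed

section \<open>The normal direction and its products with the frame\<close>

locale tubular_hypersurface =
  fixes j :: nat and lam :: int and r :: real
    and I :: "real set" and U :: "(real^3) set"
    and \<beta> :: "real \<Rightarrow> real^4" and F :: "nat \<Rightarrow> real \<Rightarrow> real^4" and k :: "nat \<Rightarrow> real \<Rightarrow> real"
  assumes j: "j \<in> {2, 3, 4}" and lam: "lam \<in> {1, - 1}" and r: "r > 0"
    and frenet: "frenet_curve j I \<beta> F k"
    and open_U: "open U" and proj_U: "(\<lambda>p. p$1) ` U = I"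
    and immersion: "immersion_on U (tube j lam r \<beta> F)"
begin

abbreviation "X \<equiv> tube j lam r \<beta> F"
abbreviation "N \<equiv> tube_normal j lam F"

definition n :: "real^3 \<Rightarrow> real^4" where
  "n p = (\<Sum>i=2..4. mu j lam i (p$2) (p$3) *\<^sub>R F i (p$1))"

text \<open>This sign is minus the causal sign of \<open>F 2\<close>, that is,
  \<open>- mink (F 2 s) (F 2 s)\<close>.\<close>

definition e :: real where
  "e = (- 1) ^ fact (4 - j)"

definition \<sigma> :: real where
  "\<sigma> = - e * of_int lam ^ j"

definition x :: "real^3 \<Rightarrow> real" where
  "x p = k 1 (p$1) * mu j lam 2 (p$2) (p$3)"

lemma e_eq: "e = (if j = 2 then 1 else - 1)"
  using j by (auto simp: e_def)

lemma \<sigma>_square: "\<sigma> * \<sigma> = 1"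
  using lam by (auto simp: \<sigma>_def e_eq simp flip: power_mult_distrib)

lemma of_int_lam_neq_0: "(of_int lam :: real) \<noteq> 0"
  using lam by auto

lemma X_eq: "X = (\<lambda>p. \<beta> (p$1) + r *\<^sub>R n p)"
  by (simp add: fun_eq_iff tube_def n_def)

lemma N_eq: "N = (\<lambda>p. \<sigma> *\<^sub>R n p)"
  by (simp add: fun_eq_iff tube_normal_def n_def \<sigma>_def e_def)

lemma fst_in_I: "p \<in> U \<Longrightarrow> p$1 \<in> I"
  using proj_U by auto

lemma mink_frame:
  assumes "s \<in> I" "i \<in> {1..4}" "l \<in> {1..4}"
  shows "mink (F i s) (F l s) = (if i \<noteq> l then 0 else if i = j then - 1 else 1)"
  using frenet assms unfolding frenet_curve_def by blast

text \<open>\<open>cosh\<^sup>2 - sinh\<^sup>2 = 1\<close> is used twice: in \<open>t\<close> for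
  the indices \<open>j\<close> and \<open>j + 2\<close>, then in \<open>w\<close>.\<close>

lemma mink_n_n:
  assumes "p \<in> U"
  shows "mink (n p) (n p) = of_int lam"
proof -
  let ?m = "\<lambda>i. mu j lam i (p$2) (p$3)" and ?\<epsilon> = "\<lambda>i. if i = j then - 1 else 1 :: real"
  have "mink (n p) (n p) = ?\<epsilon> 2 * (?m 2)\<^sup>2 + ?\<epsilon> 3 * (?m 3)\<^sup>2 + ?\<epsilon> 4 * (?m 4)\<^sup>2"
    using fst_in_I[OF assms]
    by (simp add: n_def sum_2_4 mink.add_left mink.add_right mink.scaleR_left mink.scaleR_right
        mink_frame power2_eq_square)
  also have "\<dots> = of_int lam"
    using j lam
    by (elim insertE emptyE)
      (simp_all add: mu_def wrap_index_def power_mult_distrib cosh_square_eq algebra_simps)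
  finally show ?thesis .
qed

lemma mink_F1_n:
  assumes "p \<in> U"
  shows "mink (F 1 (p$1)) (n p) = 0"
  using fst_in_I[OF assms]
  by (simp add: n_def sum_2_4 mink.add_right mink.scaleR_right mink_frame)

lemma mink_F2_n:
  assumes "p \<in> U"
  shows "mink (F 2 (p$1)) (n p) = - e * mu j lam 2 (p$2) (p$3)"
  using fst_in_I[OF assms]
  by (simp add: n_def sum_2_4 mink.add_right mink.scaleR_right mink_frame e_eq)

lemma has_derivative_curve:
  assumes "(f has_vector_derivative f') (at (p$1))"
  shows "((\<lambda>p::real^3. f (p$1)) has_derivative (\<lambda>v. (v$1) *\<^sub>R f')) (at p)"
  using has_derivative_compose[OF has_derivative_vec_nth assms[unfolded has_vector_derivative_def]]
  by simp

lemma n_differentiable: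
  assumes "p \<in> U"
  shows "n differentiable (at p)"
proof -
  have "(\<lambda>p. mu j lam i (p$2) (p$3) *\<^sub>R F i (p$1)) differentiable (at p)" if i: "i \<in> {2..4}" for i
  proof (intro differentiable_scaleR)
    have "i \<in> {2, 3, 4}" using i by auto
    then show "(\<lambda>p. mu j lam i (p$2) (p$3)) differentiable (at p)"
      using mu_has_derivative[OF j lam] unfolding differentiable_def by metis
    have "F i differentiable (at (p$1))"
      using frenet i fst_in_I[OF assms]
      by (intro smooth_on_differentiable[of I]) (auto simp: frenet_curve_def)
    then show "(\<lambda>p. F i (p$1)) differentiable (at p)"
      using has_derivative_curve unfolding vector_derivative_works differentiable_def by blast
  qed
  then show ?thesis
    unfolding n_def by (intro differentiable_sum) auto
qed

abbreviation "n' p \<equiv> frechet_derivative n (at p)"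

lemma n_has_derivative: "p \<in> U \<Longrightarrow> (n has_derivative n' p) (at p)"
  using n_differentiable by (simp add: frechet_derivative_works[symmetric])

lemma mink_n_n':
  assumes "p \<in> U"
  shows "mink (n' p v) (n p) = 0"
  using mink_constant_derivative[OF n_has_derivative[OF assms] n_has_derivative[OF assms]
      open_U assms mink_n_n, of v]
  by (simp add: mink_commute[of "n p"])

text \<open>Differentiating \<open>\<langle>F\<^sub>1, n\<rangle> = 0\<close> makes \<open>F\<^sub>1' = k\<^sub>1 F\<^sub>2\<close> the only Frenet equation that matters.\<close>

lemma mink_F1_n':
  assumes "p \<in> U"
  shows "mink (F 1 (p$1)) (n' p v) = v$1 * (e * x p)"
proof -
  have "frenet_equations j F k (p$1)"
    using frenet fst_in_I[OF assms] by (simp add: frenet_curve_def)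
  then have "(F 1 has_vector_derivative k 1 (p$1) *\<^sub>R F 2 (p$1)) (at (p$1))"
    by (auto simp: frenet_equations_def split: if_splits)
  from mink_constant_derivative[OF has_derivative_curve[OF this] n_has_derivative[OF assms]
      open_U assms mink_F1_n, of v]
  show ?thesis
    by (simp add: mink.scaleR_left mink_F2_n[OF assms] x_def)
qed

section \<open>The differential of the tube and its shape matrix\<close>

lemma X_has_derivative:
  assumes "p \<in> U"
  shows "(X has_derivative (\<lambda>v. (v$1) *\<^sub>R F 1 (p$1) + r *\<^sub>R n' p v)) (at p)"
proof -
  have "(\<beta> has_vector_derivative F 1 (p$1)) (at (p$1))"
    using frenet fst_in_I[OF assms] by (simp add: frenet_curve_def)
  then show ?thesis
    unfolding X_eq
    by (intro has_derivative_add has_derivative_curve has_derivative_scaleR_right n_has_derivative assms)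
qed

lemma X_derivative:
  assumes "p \<in> U"
  shows "frechet_derivative X (at p) v = (v$1) *\<^sub>R F 1 (p$1) + r *\<^sub>R n' p v"
  by (rule fun_cong[OF frechet_derivative_at[OF X_has_derivative[OF assms]], symmetric])

lemma hypersurface_point:
  assumes "p \<in> U"
  shows "hypersurface_point X p (n p)"
proof
  show "X differentiable (at p)" "inj (frechet_derivative X (at p))"
    using immersion assms by (auto simp: immersion_on_def)
  show "mink (frechet_derivative X (at p) v) (n p) = 0" for v
    by (simp add: X_derivative assms mink.add_left mink.scaleR_left mink_F1_n mink_n_n' del: One_nat_def)
  show "mink (n p) (n p) \<noteq> 0"
    using of_int_lam_neq_0 by (simp add: mink_n_n assms)
qed

text \<open>Pairing with \<open>F 1\<close> isolates the \<open>s\<close>-component of a tangent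
  vector; this is how the third eigenvalue is found later.\<close>

lemma mink_F1_X':
  assumes "p \<in> U"
  shows "mink (F 1 (p$1)) (frechet_derivative X (at p) v) = v$1 * (1 + e * r * x p)"
proof -
  have "mink (F 1 (p$1)) (F 1 (p$1)) = 1"
    using mink_frame[of "p$1" 1 1] fst_in_I[OF assms] j by auto
  then have "mink (F 1 (p$1)) (frechet_derivative X (at p) v) = v$1 + r * (v$1 * (e * x p))"
    unfolding X_derivative[OF assms] mink.add_right mink.scaleR_right mink_F1_n'[OF assms]
    by simp
  then show ?thesis
    by (simp add: distrib_left)
qed

text \<open>If the factor vanished, the unit vector \<open>F 1\<close> would be orthogonal to the
  tangent space and to \<open>n\<close>.\<close>

lemma A_neq_0:
  assumes "p \<in> U"
  shows "1 + e * r * x p \<noteq> 0"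
proof
  interpret hypersurface_point X p "n p"
    by (rule hypersurface_point[OF assms])
  assume "1 + e * r * x p = 0"
  then have "F 1 (p$1) = 0"
    by (intro orthogonal_to_all) (simp_all add: mink_F1_n assms pd_def mink_F1_X' del: One_nat_def)
  moreover have "mink (F 1 (p$1)) (F 1 (p$1)) \<noteq> 0"
    using mink_frame[of "p$1" 1 1] fst_in_I[OF assms] by auto
  ultimately show False
    by (simp add: mink.zero_left)
qed

lemma mean_curv_3:
  assumes p: "p \<in> U"
  shows "mean_curv X N 3 p =
    - (of_int lam ^ 3 * \<sigma> * e / r\<^sup>2) * (x p / (1 + e * r * x p))"
proof -
  interpret hypersurface_point X p "n p"
    by (rule hypersurface_point[OF p])
  have pd_N: "pd N i p = \<sigma> *\<^sub>R n' p (axis i 1)" for i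
    unfolding N_eq by (intro pd_eq has_derivative_scaleR_right n_has_derivative p)
  \<comment> \<open>The \<open>s\<close>-derivative of \<open>n\<close> is tangent, being orthogonal
    to \<open>n\<close>. Only \<open>v$1\<close> has to be known: the other two entries lie below
    the diagonal of \<open>S\<close>.\<close>
  obtain v where v: "n' p (axis 1 1) = D v"
    using tangent_cases mink_n_n'[OF p] by metis
  have "v$1 * (1 + e * r * x p) = e * x p"
    using mink_F1_n'[OF p, of "axis 1 1"] mink_F1_X'[OF p, of v] v by (simp add: axis_def)
  then have v1: "v$1 = e * x p / (1 + e * r * x p)"
    using A_neq_0[OF p] by (simp add: field_simps)
  define S :: "real^3^3" where
    "S = (\<chi> l i. if i = 1 then - \<sigma> * v$l else if l = i then - \<sigma> / r else 0)"
  have "shape_matrix X N p = S"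
  proof (rule shape_matrix_eqI)
    fix i
    show "- pd N i p = D (column i S)"
    proof (cases "i = 1")
      case True
      have "column i S = (- \<sigma>) *\<^sub>R v"
        by (simp add: True S_def column_def vec_eq_iff)
      then show ?thesis
        by (simp only: linear_scale[OF linear_D]) (simp add: True pd_N v)
    next
      case False
      have "column i S = (- \<sigma> / r) *\<^sub>R axis i 1"
        using False by (simp add: S_def column_def vec_eq_iff axis_def)
      then have "D (column i S) = (- \<sigma> / r) *\<^sub>R D (axis i 1)"
        by (simp only: linear_scale[OF linear_D])
      \<comment> \<open>In the \<open>t\<close> and \<open>w\<close> directions the curve stands
        still, so the \<open>F 1\<close> term drops out.\<close>
      also have "D (axis i 1) = r *\<^sub>R n' p (axis i 1)"
        using False by (simp add: X_derivative p axis_def)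
      finally show ?thesis
        using r by (simp add: pd_N)
    qed
  qed
  moreover have "charpoly S = [:- (- \<sigma> * v$1), 1:] * [:- (- \<sigma> / r), 1:] * [:- (- \<sigma> / r), 1:]"
    using charpoly_block_triangular[of S] by (simp add: S_def)
  ultimately have "mean_curv X N 3 p =
      normal_sign N p ^ 3 * ((- \<sigma> * v$1) * (- \<sigma> / r) * (- \<sigma> / r))"
    by (metis mean_curv_3_eq)
  also have "normal_sign N p = of_int lam"
    by (simp add: normal_sign_def N_eq mink.scaleR_left mink.scaleR_right mink_n_n p \<sigma>_square
        flip: mult.assoc)
  also have "(- \<sigma> * v$1) * (- \<sigma> / r) * (- \<sigma> / r) = - (\<sigma> / r\<^sup>2) * v$1"
    using \<sigma>_square by (simp add: power2_eq_square)
  finally show ?thesis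
    by (simp add: v1)
qed

section \<open>Critical points of the third mean curvature\<close>

lemma x_has_derivative:
  assumes "p \<in> U"
  obtains D where "(x has_derivative D) (at p)"
    and "k 1 (p$1) \<noteq> 0 \<Longrightarrow> p$2 \<noteq> 0 \<Longrightarrow> p$3 \<noteq> 0 \<Longrightarrow> D (axis 3 1) \<noteq> 0"
proof -
  obtain M where M: "((\<lambda>p::real^3. mu j lam 2 (p$2) (p$3)) has_derivative M) (at p)"
      and M3: "p$2 \<noteq> 0 \<Longrightarrow> p$3 \<noteq> 0 \<Longrightarrow> M (axis 3 1) \<noteq> 0"
    using mu_has_derivative[OF j lam, of 2] by auto
  have "k 1 differentiable (at (p$1))"
    using frenet fst_in_I[OF assms]
    by (intro smooth_on_differentiable[of I]) (auto simp: frenet_curve_def)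
  then obtain k' where "(k 1 has_vector_derivative k') (at (p$1))"
    unfolding vector_derivative_works by blast
  then have K: "((\<lambda>p::real^3. k 1 (p$1)) has_derivative (\<lambda>v. v$1 *\<^sub>R k')) (at p)"
    by (rule has_derivative_curve)
  show thesis
    by (rule that[OF has_derivative_mult[OF K M, folded x_def]])
      (use M3 in \<open>simp add: axis_def\<close>)
qed

text \<open>\<open>y \<mapsto> y / (1 + e r y)\<close> has derivative
  \<open>1 / (1 + e r y)\<^sup>2\<close>, which never vanishes, so the \<open>w\<close>-derivative
  of \<open>x\<close> must vanish along with that of the third mean curvature.\<close>

lemma k1_eq_0:
  assumes p: "p \<in> U" and pd: "pd (mean_curv X N 3) 3 p = 0" and ne: "p$2 \<noteq> 0" "p$3 \<noteq> 0"
  shows "k 1 (p$1) = 0"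
proof (rule ccontr)
  assume k1: "k 1 (p$1) \<noteq> 0"
  obtain D where D: "(x has_derivative D) (at p)" "D (axis 3 1) \<noteq> 0"
    using x_has_derivative[OF p] k1 ne by metis
  define C where "C = - (of_int lam ^ 3 * \<sigma> * e / r\<^sup>2)"
  have "C \<noteq> 0"
    using of_int_lam_neq_0 \<sigma>_square r by (auto simp: C_def e_eq)
  have "((\<lambda>y. C * (y / (1 + e * r * y))) has_field_derivative C * (1 / (1 + e * r * x p)\<^sup>2))
      (at (x p))"
    using A_neq_0[OF p]
    by (auto intro!: derivative_eq_intros simp: field_simps power2_eq_square)
  from DERIV_compose_FDERIV[OF this D(1)]
  have "(mean_curv X N 3 has_derivative (\<lambda>v. D v * (C * (1 / (1 + e * r * x p)\<^sup>2)))) (at p)"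
    by (rule has_derivative_transform_within_open[OF _ open_U p]) (simp add: mean_curv_3 C_def)
  then have "pd (mean_curv X N 3) 3 p = D (axis 3 1) * (C * (1 / (1 + e * r * x p)\<^sup>2))"
    by (rule pd_eq)
  then show False
    using pd D(2) \<open>C \<noteq> 0\<close> A_neq_0[OF p] by simp
qed

lemma exists_generic_point:
  assumes "p \<in> U"
  obtains q where "q \<in> U" "q$1 = p$1" "q$2 \<noteq> 0" "q$3 \<noteq> 0"
proof -
  \<comment> \<open>Moving diagonally in \<open>t\<close> and \<open>w\<close> fixes
    \<open>s\<close>, and all but two small shifts make both coordinates nonzero.\<close>
  define q where "q = (\<lambda>\<delta>. p + \<delta> *\<^sub>R (axis 2 1 + axis 3 1 :: real^3))"
  have "(q \<longlongrightarrow> p + 0 *\<^sub>R (axis 2 1 + axis 3 1)) (at 0)"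
    unfolding q_def by (intro tendsto_intros)
  then have "(q \<longlongrightarrow> p) (at 0)"
    by simp
  then have "\<forall>\<^sub>F \<delta> in at 0. q \<delta> \<in> U"
    using topological_tendstoD open_U assms by blast
  moreover have "\<forall>\<^sub>F \<delta> in at 0. \<delta> \<noteq> - p$2" "\<forall>\<^sub>F \<delta> in at 0. \<delta> \<noteq> - p$3"
    by (rule eventually_neq_at_within)+
  ultimately have "\<forall>\<^sub>F \<delta> in at 0. q \<delta> \<in> U \<and> \<delta> \<noteq> - p$2 \<and> \<delta> \<noteq> - p$3"
    by eventually_elim simp
  then obtain \<delta> where "q \<delta> \<in> U" "\<delta> \<noteq> - p$2" "\<delta> \<noteq> - p$3"
    using eventually_happens[of _ "at (0::real)"] by auto
  then show thesis
    by (intro that[of "q \<delta>"]) (auto simp: q_def axis_def)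
qed

lemma L2_gauss_eq_0:
  assumes m: "\<And>p. p \<in> U \<Longrightarrow> L2_gauss X N p = m p *\<^sub>R N p" and p: "p \<in> U"
  shows "L2_gauss X N p = 0"
proof -
  have pd_0: "pd (mean_curv X N 3) l q = 0" if q: "q \<in> U" for q l
  proof -
    interpret hypersurface_point X q "n q"
      by (rule hypersurface_point[OF q])
    define h where "h = 3 * mean_curv X N 1 q * mean_curv X N 3 q"
    define c where "c = - normal_sign N q * (real (3 choose 3) * (- normal_sign N q)\<^sup>2)"
    have "normal_sign N q \<noteq> 0"
      using nonnull \<sigma>_square
      by (auto simp: normal_sign_def N_eq mink.scaleR_left mink.scaleR_right)
    then have c: "c \<noteq> 0"
      by (simp add: c_def)
    \<comment> \<open>Dividing by \<open>c\<close> and moving the normal term to the right exhibits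
      the gradient as a multiple of \<open>n q\<close>.\<close>
    have "c *\<^sub>R (gradient X (mean_curv X N 3) q + h *\<^sub>R N q) = m q *\<^sub>R N q"
      using m[OF q] by (simp only: L2_gauss_def c_def h_def)
    then have "inverse c *\<^sub>R c *\<^sub>R (gradient X (mean_curv X N 3) q + h *\<^sub>R N q)
        = inverse c *\<^sub>R m q *\<^sub>R N q"
      by (rule arg_cong)
    then have "gradient X (mean_curv X N 3) q + h *\<^sub>R N q = (inverse c * m q) *\<^sub>R N q"
      using c by simp
    then have "gradient X (mean_curv X N 3) q = ((inverse c * m q - h) * \<sigma>) *\<^sub>R n q"
      by (simp add: N_eq algebra_simps)
    then show ?thesis
      by (rule gradient_normal)
  qed
  \<comment> \<open>\<open>p\<close> itself may have \<open>t w = 0\<close>; since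
    \<open>k 1\<close> sees only \<open>s\<close>, its value can be read off at
    \<open>q\<close>.\<close>
  obtain q where "q \<in> U" "q$1 = p$1" "q$2 \<noteq> 0" "q$3 \<noteq> 0"
    using exists_generic_point[OF p] .
  then have "k 1 (p$1) = 0"
    using k1_eq_0[of q] pd_0 by metis
  then have "mean_curv X N 3 p = 0"
    by (simp add: mean_curv_3[OF p] x_def)
  then show ?thesis
    by (simp add: L2_gauss_def gradient_def pd_0 p)
qed

end

theorem theorem15:
  fixes j :: nat and lam :: int and r :: real
    and I :: "real set" and U :: "(real^3) set"
    and \<beta> :: "real \<Rightarrow> real^4" and F :: "nat \<Rightarrow> real \<Rightarrow> real^4" and k :: "nat \<Rightarrow> real \<Rightarrow> real"
  assumes "j \<in> {2, 3, 4}" and "lam \<in> {1, - 1}" and "r > 0"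
    and "open I" and "is_interval I"
    and "frenet_curve j I \<beta> F k"
    and "open U" and "connected U" and "(\<lambda>p. p$1) ` U = I"
    and "immersion_on U (tube j lam r \<beta> F)"
  shows "\<not> first_kind_L2_pointwise_1_type U (tube j lam r \<beta> F) (tube_normal j lam F)"
proof
  interpret tubular_hypersurface j lam r I U \<beta> F k
    using assms by unfold_locales
  assume "first_kind_L2_pointwise_1_type U X N"
  then obtain m p where m: "\<And>p. p \<in> U \<Longrightarrow> L2_gauss X N p = m p *\<^sub>R N p"
      and p: "p \<in> U" "m p \<noteq> 0"
    unfolding first_kind_L2_pointwise_1_type_def by auto
  \<comment> \<open>The left side vanishes while \<open>m p\<close> does not, which contradicts
    non-nullity of the normal.\<close>
  have "N p = 0"
    using m[OF p(1)] L2_gauss_eq_0[OF m p(1)] p(2) by simp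
  moreover have "mink (N p) (N p) \<noteq> 0"
    using mink_n_n[OF p(1)] of_int_lam_neq_0 \<sigma>_square
    by (auto simp: N_eq mink.scaleR_left mink.scaleR_right)
  ultimately show False
    by (simp add: mink.zero_left)
qed

end
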